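(* Let $\Delta\subset[0,1]^2$ be the open convex polygon with corners $(0,1),(1/2,1),(1/3,2/3),(0,1/2)$. Then $\Delta$ is a dimension trap for the baker's map, i.e. $\dim_{\mathrm H}\mathcal J(\Delta)=0$.
   Context: Let $X=[0,1]^2$. The baker's map is $B(x,y)=(2x,\frac y2)$ if $0\le x<\frac12$ and $B(x,y)=(2x-1,\frac{y+1}2)$ if $\frac12\le x<1$. For a bi-infinite sequence $u=(x_n)_{n\in\mathbb Z}\in\{0,1\}^{\mathbb Z}$, written $\dots x_{-1}x_0\cdot x_1x_2\dots$, put $\pi(u)=\left(\sum_{n\ge1}x_n2^{-n},\ \sum_{n\ge0}x_{-n}2^{-n-1}\right)$. The map $\pi$ conjugates the left shift $\sigma$ and $B$; points and sequences are used interchangeably, so the $B$-orbit of the point $\pi(u)$ is $(\pi(\sigma^n u))_{n\in\mathbb Z}$. For $H\subset X$ the survivor set is $\mathcal J(H)=\{(x,y)\in X: B^n(x,y)\notin H \text{ for all } n\in\mathbb Z\}$, i.e. $\mathcal J(H)=\{\pi(u): \pi(\sigma^nu)\notin H\ \text{for all } n\in\mathbb Z\}$. An open set $H$ is a dimension trap if $\dim_{\mathrm H}\mathcal J(H)=0$ (Hausdorff dimension). *)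

theory Defs
  imports "HOL-Analysis.Analysis"
begin

section \<open>Hausdorff measure and dimension\<close>

text \<open>The summand \<open>diam(U)^s\<close>, with the usual conventions \<open>diam({})^s = 0\<close> and \<open>diam(U)^0 = 1\<close> for
  nonempty \<open>U\<close>; the explicit cases are needed because \<^term>\<open>0 powr 0 = (0::real)\<close>.\<close>

definition hausdorff_gauge :: "real \<Rightarrow> 'a::metric_space set \<Rightarrow> ennreal" where
  "hausdorff_gauge s U =
     (if U = {} then 0 else if s = 0 then 1 else ennreal (diameter U powr s))"

text \<open>Boundedness is required explicitly since \<^const>\<open>diameter\<close> is only meaningful on bounded
  sets. Finite covers are included, as members of the cover may be empty.\<close>

definition hausdorff_premeasure :: "real \<Rightarrow> real \<Rightarrow> 'a::metric_space set \<Rightarrow> ennreal" where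
  "hausdorff_premeasure s \<delta> A =
     Inf {(\<Sum>n. hausdorff_gauge s (U n)) | U :: nat \<Rightarrow> 'a set.
            A \<subseteq> (\<Union>n. U n) \<and> (\<forall>n. bounded (U n) \<and> diameter (U n) \<le> \<delta>)}"

definition hausdorff_measure :: "real \<Rightarrow> 'a::metric_space set \<Rightarrow> ennreal" where
  "hausdorff_measure s A = (SUP \<delta>\<in>{0<..}. hausdorff_premeasure s \<delta> A)"

definition hausdorff_dim :: "'a::metric_space set \<Rightarrow> ennreal" where
  "hausdorff_dim A = Inf {ennreal s | s. 0 \<le> s \<and> hausdorff_measure s A = 0}"


section \<open>The baker's map and its symbolic coding\<close>

definition unit_square :: "(real \<times> real) set" where
  "unit_square = {0..1} \<times> {0..1}"

text \<open>The map is only meant for \<open>0 \<le> x < 1\<close>.\<close>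

definition baker :: "real \<times> real \<Rightarrow> real \<times> real" where
  "baker = (\<lambda>(x, y). if x < 1/2 then (2 * x, y / 2) else (2 * x - 1, (y + 1) / 2))"

definition binary_seqs :: "(int \<Rightarrow> nat) set" where
  "binary_seqs = {u. \<forall>k. u k \<in> {0, 1}}"

text \<open>The \<open>n\<close>-th power of the left shift, for any integer \<open>n\<close>.\<close>

definition shift :: "int \<Rightarrow> (int \<Rightarrow> nat) \<Rightarrow> (int \<Rightarrow> nat)" where
  "shift n u = (\<lambda>k. u (k + n))"

text \<open>The first sum is \<open>\<Sum>\<^sub>n\<^sub>\<ge>\<^sub>1 x\<^sub>n 2\<^sup>-\<^sup>n\<close>, reindexed to start at \<open>0\<close>.\<close>

definition coding :: "(int \<Rightarrow> nat) \<Rightarrow> real \<times> real" where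
  "coding u = ((\<Sum>n. real (u (int n + 1)) / 2 ^ (n + 1)),
               (\<Sum>n. real (u (- int n)) / 2 ^ (n + 1)))"

text \<open>Orbits are taken symbolically: the orbit of \<open>coding u\<close> is the bi-infinite sequence
  \<open>coding (shift n u)\<close>. This gives a meaning to negative iterates and to points with \<open>x = 1\<close>, and a
  point with several codes survives as soon as one of its codes avoids \<open>H\<close>. Lemma
  \<open>coding_shift\<close> below relates this to \<^const>\<open>baker\<close>.\<close>

definition survivor_set :: "(real \<times> real) set \<Rightarrow> (real \<times> real) set" where
  "survivor_set H = {coding u | u. u \<in> binary_seqs \<and> (\<forall>n. coding (shift n u) \<notin> H)}"

text \<open>The ambient space is the closed square, so openness is relative to it.\<close>

definition dimension_trap :: "(real \<times> real) set \<Rightarrow> bool" where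
  "dimension_trap H \<longleftrightarrow>
     openin (top_of_set unit_square) H \<and> hausdorff_dim (survivor_set H) = 0"

definition Delta :: "(real \<times> real) set" where
  "Delta = interior (convex hull {(0, 1), (1/2, 1), (1/3, 2/3), (0, 1/2)})"


section \<open>The coding conjugates the shift and the baker's map\<close>

lemma binary_summable:
  assumes "\<And>n. a n \<in> {0, 1 :: nat}"
  shows "summable (\<lambda>n. real (a n) / 2 ^ (n + 1))"
proof (rule summable_comparison_test')
  show "summable (\<lambda>n. (1/2 :: real) ^ n)" by (rule summable_geometric) simp
  fix n :: nat
  show "norm (real (a n) / 2 ^ (n + 1)) \<le> (1/2) ^ n"
    using assms[of n] by (auto simp: power_one_over field_simps)
qed

lemma binary_sum_head:
  assumes "\<And>n. a n \<in> {0, 1 :: nat}"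
  shows "(\<Sum>n. real (a n) / 2 ^ (n + 1)) = (real (a 0) + (\<Sum>n. real (a (Suc n)) / 2 ^ (n + 1))) / 2"
proof -
  have "(\<Sum>n. real (a (Suc n)) / 2 ^ (n + 1) / 2) = (\<Sum>n. real (a (Suc n)) / 2 ^ (n + 1)) / 2"
    by (rule suminf_divide[OF binary_summable]) (rule assms)
  moreover have "(\<Sum>n. real (a (Suc n)) / 2 ^ (Suc n + 1))
      = (\<Sum>n. real (a n) / 2 ^ (n + 1)) - real (a 0) / 2 ^ (0 + 1)"
    by (rule suminf_split_head[OF binary_summable]) (rule assms)
  moreover have "(\<lambda>n. real (a (Suc n)) / 2 ^ (Suc n + 1)) = (\<lambda>n. real (a (Suc n)) / 2 ^ (n + 1) / 2)"
    by (simp add: field_simps)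
  ultimately show ?thesis by (simp add: add_divide_distrib)
qed

lemma binary_sum_less_1:
  assumes "\<And>n. a n \<in> {0, 1 :: nat}" and "a m = 0"
  shows "(\<Sum>n. real (a n) / 2 ^ (n + 1)) < 1"
proof -
  have s: "(\<lambda>n. (1/2 :: real) ^ Suc n) sums 1" by (rule power_half_series)
  have "0 < (\<Sum>n. (1/2) ^ Suc n - real (a n) / 2 ^ (n + 1))"
  proof (rule suminf_pos2[where i = m])
    show "summable (\<lambda>n. (1/2) ^ Suc n - real (a n) / 2 ^ (n + 1))"
      by (rule summable_diff[OF sums_summable[OF s] binary_summable[OF assms(1)]])
    show "0 \<le> (1/2) ^ Suc n - real (a n) / 2 ^ (n + 1)" for n
      using assms(1)[of n] by (auto simp: power_one_over)
    show "0 < (1/2) ^ Suc m - real (a m) / 2 ^ (m + 1)"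
      using assms(2) by simp
  qed
  also have "\<dots> = 1 - (\<Sum>n. real (a n) / 2 ^ (n + 1))"
    using suminf_diff[OF sums_summable[OF s] binary_summable[OF assms(1)]] sums_unique[OF s]
    by simp
  finally show ?thesis by simp
qed

text \<open>If \<open>x\<^sub>n = 1\<close> for all \<open>n \<ge> 2\<close>, the \<open>x\<close>-coordinate is \<open>1/2\<close> or \<open>1\<close>; there \<^const>\<open>baker\<close>
  follows the other binary expansion of \<open>1/2\<close>, respectively is not meaningful.\<close>

lemma coding_shift:
  assumes "u \<in> binary_seqs" and "m \<ge> 2" and "u m = 0"
  shows "coding (shift 1 u) = baker (coding u)"
proof -
  define t where "t = (\<Sum>n. real (u (int n + 2)) / 2 ^ (n + 1))"
  define y where "y = (\<Sum>n. real (u (- int n)) / 2 ^ (n + 1))"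
  have b: "u k \<in> {0, 1}" for k using assms(1) by (auto simp: binary_seqs_def)
  have "t < 1"
    unfolding t_def using binary_sum_less_1[of "\<lambda>n. u (int n + 2)" "nat (m - 2)"] b assms(2,3)
    by auto
  moreover have "0 \<le> t"
    unfolding t_def using binary_summable[of "\<lambda>n. u (int n + 2)"] b by (intro suminf_nonneg) auto
  moreover have "coding u = ((real (u 1) + t) / 2, y)"
    using binary_sum_head[of "\<lambda>n. u (int n + 1)"] b
    by (simp add: coding_def t_def y_def add.commute)
  moreover have "coding (shift 1 u) = (t, (real (u 1) + y) / 2)"
    using binary_sum_head[of "\<lambda>n. u (1 - int n)"] b
    by (simp add: coding_def shift_def t_def y_def add.commute)
  ultimately show ?thesis
    using b[of 1] by (auto simp: baker_def field_simps)
qed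

end

(* Next to an occurrence of 10 in a surviving sequence, the hole forces a run 1^a 0 with a >= 2 to be
   followed by 1^a, and a run 1 0^b with b >= 2 to be preceded by 0^b.  Hence, from some point on, a
   surviving sequence is constant, or has isolated 0s separated by runs of 1s of nondecreasing length,
   or has isolated 1s separated by runs of 0s of nonincreasing length.  So it is eventually periodic,
   or its 0s become arbitrarily sparse.  In both cases, for suitable arbitrarily large M, its tail is
   cut into blocks of length M taken from a set of at most M + 1 words; the left tails follow by the
   symmetry of the hole.  Since (M + 1)^2 < 2^(M s) for large M, counting words shows that each of the
   countably many resulting pieces has s-dimensional Hausdorff measure 0. *)

theory Submission
  imports Defs "HOL-Real_Asymp.Real_Asymp"
begin

section \<open>Null sets of Hausdorff measures\<close>

text \<open>This is vanishing of the Hausdorff content: the covers carry no bound on their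
  diameters, which makes them easy to build and combine. For \<open>s > 0\<close> it already gives
  measure zero, by \<open>hausdorff_measure_eq_0\<close>.\<close>

definition hausdorff_null :: "real \<Rightarrow> 'a::metric_space set \<Rightarrow> bool" where
  "hausdorff_null s A \<longleftrightarrow>
     (\<forall>e>0. \<exists>U :: nat \<Rightarrow> 'a set. A \<subseteq> (\<Union>n. U n) \<and> (\<forall>n. bounded (U n)) \<and>
        (\<Sum>n. hausdorff_gauge s (U n)) \<le> ennreal e)"

lemma hausdorff_null_subset:
  assumes "hausdorff_null s B" and "A \<subseteq> B"
  shows "hausdorff_null s A"
  using assms unfolding hausdorff_null_def by (meson subset_trans)

text \<open>Every summand is bounded by the whole sum, so a cover with total at most
  \<open>\<delta> powr s\<close> has all diameters at most \<open>\<delta>\<close> and is admissible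
  at scale \<open>\<delta>\<close>. This is where \<open>s > 0\<close> enters.\<close>

lemma hausdorff_measure_eq_0:
  fixes A :: "'a::metric_space set"
  assumes s: "s > 0" and A: "hausdorff_null s A"
  shows "hausdorff_measure s A = 0"
proof -
  have "hausdorff_premeasure s \<delta> A = 0" if \<delta>: "\<delta> > 0" for \<delta>
  proof -
    have "hausdorff_premeasure s \<delta> A \<le> ennreal e" if e: "e > 0" for e
    proof -
      define e' where "e' = min e (\<delta> powr s)"
      have "e' > 0" using e \<delta> by (simp add: e'_def)
      then obtain U where U: "A \<subseteq> (\<Union>n. U n)" "\<And>n. bounded (U n)"
        and sum: "(\<Sum>n. hausdorff_gauge s (U n)) \<le> ennreal e'"
        using A unfolding hausdorff_null_def by blast
      have "diameter (U n) \<le> \<delta>" for n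
      proof (cases "U n = {}")
        case True
        then show ?thesis using \<delta> by (simp add: diameter_def)
      next
        case False
        have "hausdorff_gauge s (U n) \<le> (\<Sum>n. hausdorff_gauge s (U n))"
          using sum_le_suminf[OF summableI, of "{n}" "\<lambda>n. hausdorff_gauge s (U n)"] by simp
        also have "\<dots> \<le> ennreal (\<delta> powr s)"
          using sum by (rule order_trans) (simp add: e'_def ennreal_leI)
        finally have "diameter (U n) powr s \<le> \<delta> powr s"
          using False s by (simp add: hausdorff_gauge_def)
        then show ?thesis
          using s \<delta> powr_less_mono2[of s \<delta> "diameter (U n)"] by fastforce
      qed
      with U have "hausdorff_premeasure s \<delta> A \<le> (\<Sum>n. hausdorff_gauge s (U n))"
        unfolding hausdorff_premeasure_def by (intro Inf_lower) blast
      also have "\<dots> \<le> ennreal e"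
        using sum by (rule order_trans) (simp add: e'_def ennreal_leI)
      finally show ?thesis .
    qed
    then have "hausdorff_premeasure s \<delta> A \<le> 0"
      by - (rule ennreal_le_epsilon, simp)
    then show ?thesis by simp
  qed
  then have "hausdorff_measure s A \<le> 0"
    unfolding hausdorff_measure_def by (intro SUP_least) simp
  then show ?thesis by simp
qed

lemma hausdorff_null_UN:
  assumes "\<And>i :: nat. hausdorff_null s (A i)"
  shows "hausdorff_null s (\<Union>i. A i)"
  unfolding hausdorff_null_def
proof (intro allI impI)
  fix e :: real
  assume e: "e > 0"
  \<comment> \<open>The i-th set gets the share \<open>e / 2 ^ (i + 1)\<close>; the double family of
    covers is then enumerated by \<open>prod_decode\<close>.\<close>
  have "\<exists>U :: nat \<Rightarrow> _ set. A i \<subseteq> (\<Union>n. U n) \<and> (\<forall>n. bounded (U n)) \<and>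
      (\<Sum>n. hausdorff_gauge s (U n)) \<le> ennreal (e * (1/2) ^ Suc i)" for i
    using assms[of i] e unfolding hausdorff_null_def by simp
  then obtain U where U: "\<And>i. A i \<subseteq> (\<Union>n. U i n)" "\<And>i n. bounded (U i n)"
    and sum: "\<And>i. (\<Sum>n. hausdorff_gauge s (U i n)) \<le> ennreal (e * (1/2) ^ Suc i)"
    by metis
  define V where "V n = (case prod_decode n of (i, j) \<Rightarrow> U i j)" for n
  have "(\<Sum>n. hausdorff_gauge s (V n)) = (\<Sum>i. \<Sum>n. hausdorff_gauge s (U i n))"
    using suminf_ennreal_2dimen[of "\<lambda>i. \<Sum>n. hausdorff_gauge s (U i n)"
        "\<lambda>(i, j). hausdorff_gauge s (U i j)"]
    by (simp add: V_def case_prod_beta)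
  also have "\<dots> \<le> (\<Sum>i. ennreal (e * (1/2) ^ Suc i))"
    using sum by (intro suminf_le) auto
  also have "\<dots> = ennreal e"
    using sums_mult[OF power_half_series, of e] e
    by (subst suminf_ennreal_eq) auto
  finally have "(\<Sum>n. hausdorff_gauge s (V n)) \<le> ennreal e" .
  moreover have "(\<Union>i. A i) \<subseteq> (\<Union>n. V n)"
  proof
    fix x assume "x \<in> (\<Union>i. A i)"
    then obtain i j where "x \<in> U i j" using U(1) by blast
    then have "x \<in> V (prod_encode (i, j))" by (simp add: V_def)
    then show "x \<in> (\<Union>n. V n)" by blast
  qed
  moreover have "\<forall>n. bounded (V n)" using U(2) by (simp add: V_def case_prod_beta)
  ultimately show "\<exists>U. (\<Union>i. A i) \<subseteq> (\<Union>n. U n) \<and> (\<forall>n. bounded (U n)) \<and>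
      (\<Sum>n. hausdorff_gauge s (U n)) \<le> ennreal e" by blast
qed

lemma hausdorff_null_countable_UN:
  assumes "countable I" and "\<And>i. i \<in> I \<Longrightarrow> hausdorff_null s (A i)"
  shows "hausdorff_null s (\<Union>i\<in>I. A i)"
proof (cases "I = {}")
  case True
  have "hausdorff_null s {}"
    unfolding hausdorff_null_def
    by (intro allI impI exI[of _ "\<lambda>_. {}"]) (simp add: hausdorff_gauge_def)
  with True show ?thesis by simp
next
  case False
  have "hausdorff_null s (\<Union>n. A (from_nat_into I n))"
    using assms(2) from_nat_into[OF False] by (intro hausdorff_null_UN) blast
  moreover have "(\<Union>i\<in>I. A i) \<subseteq> (\<Union>n. A (from_nat_into I n))"
  proof
    fix x assume "x \<in> (\<Union>i\<in>I. A i)"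
    then obtain i where i: "i \<in> I" "x \<in> A i" by blast
    moreover obtain n where "from_nat_into I n = i"
      using from_nat_into_surj[OF assms(1) i(1)] by blast
    ultimately show "x \<in> (\<Union>n. A (from_nat_into I n))" by blast
  qed
  ultimately show ?thesis by (rule hausdorff_null_subset)
qed

text \<open>The form in which counting arguments apply: number of pieces times a common bound on
  \<open>diam^s\<close>. A finite cover becomes a sequence by padding with empty sets, whose gauge
  is 0. The index type is free so that words can serve as indices.\<close>

lemma hausdorff_null_finite_covers:
  fixes A :: "'a::metric_space set"
  assumes s: "s > 0"
    and cover: "\<And>e. e > 0 \<Longrightarrow> \<exists>I (U :: 'b \<Rightarrow> 'a set) d. finite I \<and> A \<subseteq> (\<Union>i\<in>I. U i) \<and>
      (\<forall>i\<in>I. bounded (U i) \<and> diameter (U i) \<le> d) \<and> 0 \<le> d \<and> real (card I) * d powr s \<le> e"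
  shows "hausdorff_null s A"
  unfolding hausdorff_null_def
proof (intro allI impI)
  fix e :: real
  assume "e > 0"
  from cover[OF this] obtain I and U :: "'b \<Rightarrow> 'a set" and d where I: "finite I"
    and A: "A \<subseteq> (\<Union>i\<in>I. U i)" and U: "\<And>i. i \<in> I \<Longrightarrow> bounded (U i) \<and> diameter (U i) \<le> d"
    and d: "0 \<le> d" "real (card I) * d powr s \<le> e" by blast
  obtain h where h: "bij_betw h {0..<card I} I"
    using ex_bij_betw_nat_finite[OF I] by blast
  define V where "V n = (if n < card I then U (h n) else {})" for n
  have hI: "h n \<in> I" if "n < card I" for n
    using h that by (auto simp: bij_betw_def)
  have gauge: "hausdorff_gauge s (V n) \<le> ennreal (d powr s)" for n
    using s U[OF hI[of n]] diameter_ge_0[of "U (h n)"]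
    by (auto simp: hausdorff_gauge_def V_def intro!: ennreal_leI powr_mono2)
  have "(\<Sum>n. hausdorff_gauge s (V n)) = (\<Sum>n<card I. hausdorff_gauge s (V n))"
    by (rule suminf_finite) (auto simp: V_def hausdorff_gauge_def)
  also have "\<dots> \<le> (\<Sum>n<card I. ennreal (d powr s))"
    by (rule sum_mono) (rule gauge)
  also have "\<dots> = ennreal (real (card I) * d powr s)"
    by (simp add: ennreal_mult ennreal_of_nat_eq_real_of_nat)
  also have "\<dots> \<le> ennreal e" using d(2) by (rule ennreal_leI)
  finally have "(\<Sum>n. hausdorff_gauge s (V n)) \<le> ennreal e" .
  moreover have "A \<subseteq> (\<Union>n. V n)"
  proof
    fix x assume "x \<in> A"
    then obtain i where "i \<in> I" "x \<in> U i" using A by blast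
    moreover have "i \<in> h ` {0..<card I}"
      using \<open>i \<in> I\<close> bij_betw_imp_surj_on[OF h] by simp
    then obtain n where "n < card I" "h n = i" by auto
    ultimately have "x \<in> V n" by (simp add: V_def)
    then show "x \<in> (\<Union>n. V n)" by blast
  qed
  moreover have "\<forall>n. bounded (V n)" using U hI by (simp add: V_def)
  ultimately show "\<exists>U. A \<subseteq> (\<Union>n. U n) \<and> (\<forall>n. bounded (U n)) \<and>
      (\<Sum>n. hausdorff_gauge s (U n)) \<le> ennreal e" by blast
qed

lemma hausdorff_dim_eq_0:
  assumes "\<And>s. s > 0 \<Longrightarrow> hausdorff_null s A"
  shows "hausdorff_dim A = 0"
proof -
  have "hausdorff_dim A \<le> ennreal s" if "s > 0" for s
    unfolding hausdorff_dim_def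
    using hausdorff_measure_eq_0[OF that assms[OF that]] that by (intro Inf_lower) auto
  then have "hausdorff_dim A \<le> 0"
    by - (rule ennreal_le_epsilon, simp)
  then show ?thesis by simp
qed

section \<open>Binary expansions\<close>

definition bin_seq :: "(nat \<Rightarrow> nat) \<Rightarrow> bool" where
  "bin_seq v \<longleftrightarrow> (\<forall>n. v n \<in> {0, 1})"

definition bin_val :: "(nat \<Rightarrow> nat) \<Rightarrow> real" where
  "bin_val v = (\<Sum>n. real (v n) / 2 ^ (n + 1))"

lemma bin_seqD: "bin_seq v \<Longrightarrow> v n = 0 \<or> v n = 1"
  by (auto simp: bin_seq_def)

lemma bin_seq_add: "bin_seq v \<Longrightarrow> bin_seq (\<lambda>n. v (n + k))"
  and bin_seq_Suc: "bin_seq v \<Longrightarrow> bin_seq (\<lambda>n. v (Suc n))"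
  by (auto simp: bin_seq_def)

lemma bin_val_head: "bin_seq v \<Longrightarrow> bin_val v = (real (v 0) + bin_val (\<lambda>n. v (Suc n))) / 2"
  unfolding bin_val_def bin_seq_def by (rule binary_sum_head) blast

text \<open>The all-ones series sums to 1. This identity turns every fact about leading zeros into
  one about leading ones.\<close>

lemma bin_val_complement:
  assumes "bin_seq v"
  shows "bin_val (\<lambda>n. 1 - v n) = 1 - bin_val v"
proof -
  have s: "(\<lambda>n. (1/2 :: real) ^ Suc n) sums 1" by (rule power_half_series)
  have "summable (\<lambda>n. real (v n) / 2 ^ (n + 1))"
    by (rule binary_summable) (use assms in \<open>auto simp: bin_seq_def\<close>)
  then have "(\<lambda>n. (1/2) ^ Suc n - real (v n) / 2 ^ (n + 1)) sums (1 - bin_val v)"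
    unfolding bin_val_def by (intro sums_diff s summable_sums)
  moreover have "(1/2) ^ Suc n - real (v n) / 2 ^ (n + 1) = real (1 - v n) / 2 ^ (n + 1)" for n
    using bin_seqD[OF assms, of n] by (auto simp: power_one_over)
  ultimately show ?thesis by (simp add: bin_val_def sums_iff)
qed

lemma bin_seq_complement: "bin_seq (\<lambda>n. 1 - v n)" if "bin_seq v"
  using that by (auto simp: bin_seq_def)

lemma bin_val_less_1: "bin_seq v \<Longrightarrow> v m = 0 \<Longrightarrow> bin_val v < 1"
  unfolding bin_val_def bin_seq_def by (rule binary_sum_less_1) auto

lemma bin_val_pos: "bin_seq v \<Longrightarrow> v m = 1 \<Longrightarrow> 0 < bin_val v"
  using bin_val_less_1[OF bin_seq_complement, of v m] bin_val_complement[of v] by simp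

lemma bin_val_nonneg: "bin_seq v \<Longrightarrow> 0 \<le> bin_val v"
  unfolding bin_val_def
  using binary_summable[of v] by (intro suminf_nonneg) (auto simp: bin_seq_def)

lemma bin_val_le_1: "bin_seq v \<Longrightarrow> bin_val v \<le> 1"
  using bin_val_nonneg[OF bin_seq_complement, of v] bin_val_complement[of v] by simp

lemma bin_val_zeros:
  assumes "bin_seq v" and "\<And>i. i < a \<Longrightarrow> v i = 0"
  shows "bin_val v = bin_val (\<lambda>n. v (n + a)) / 2 ^ a"
  using assms
proof (induction a arbitrary: v)
  case (Suc a)
  have "bin_val (\<lambda>n. v (Suc n)) = bin_val (\<lambda>n. v (n + Suc a)) / 2 ^ a"
    using Suc.IH[OF bin_seq_Suc[OF Suc.prems(1)]] Suc.prems(2) by simp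
  with bin_val_head[OF Suc.prems(1)] Suc.prems(2)[of 0] show ?case by simp
qed simp

lemma bin_val_ones:
  assumes "bin_seq v" and "\<And>i. i < a \<Longrightarrow> v i = 1"
  shows "bin_val v = 1 - (1 - bin_val (\<lambda>n. v (n + a))) / 2 ^ a"
  using bin_val_zeros[OF bin_seq_complement[OF assms(1)], of a] assms(2)
    bin_val_complement[OF assms(1)] bin_val_complement[OF bin_seq_add[OF assms(1), of a]]
  by simp

text \<open>A leading 1 would make the value at least 1/2, so the first digit is 0; dropping it
  doubles both the value and the bound. Strictness matters: \<open>1 / 2 ^ a\<close> itself has an
  expansion with a 1 at index \<open>a - 1\<close>.\<close>

lemma zeros_if_bin_val_less:
  assumes "bin_seq v" and "bin_val v < 1 / 2 ^ a" and "i < a"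
  shows "v i = 0"
  using assms
proof (induction a arbitrary: v i)
  case (Suc a)
  note head = bin_val_head[OF Suc.prems(1)]
  have nonneg: "0 \<le> bin_val (\<lambda>n. v (Suc n))"
    by (rule bin_val_nonneg[OF bin_seq_Suc[OF Suc.prems(1)]])
  have "(1::real) / 2 ^ Suc a \<le> 1 / 2" by (simp add: field_simps)
  with Suc.prems(2) have "bin_val v < 1 / 2" by (rule less_le_trans)
  with head nonneg have "real (v 0) < 1" by argo
  then have v0: "v 0 = 0" by simp
  show ?case
  proof (cases i)
    case (Suc j)
    have "bin_val (\<lambda>n. v (Suc n)) < 1 / 2 ^ a"
      using head v0 Suc.prems(2) by (simp add: field_simps flip: mult.assoc)
    from Suc.IH[OF bin_seq_Suc[OF Suc.prems(1)] this, of j] show ?thesis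
      using Suc Suc.prems(3) by simp
  qed (simp add: v0)
qed simp

lemma ones_if_bin_val_greater:
  assumes "bin_seq v" and "bin_val v > 1 - 1 / 2 ^ a" and "i < a"
  shows "v i = 1"
  using zeros_if_bin_val_less[OF bin_seq_complement[OF assms(1)] _ assms(3)] assms(2)
    bin_val_complement[OF assms(1)] bin_seqD[OF assms(1), of i]
  by auto

text \<open>The tails have values in [0,1], and each common leading digit halves the
  difference.\<close>

lemma bin_val_prefix:
  assumes "bin_seq v" "bin_seq w" and "\<And>i. i < n \<Longrightarrow> v i = w i"
  shows "\<bar>bin_val v - bin_val w\<bar> \<le> 1 / 2 ^ n"
  using assms
proof (induction n arbitrary: v w)
  case 0
  then show ?case
    using bin_val_nonneg[of v] bin_val_nonneg[of w] bin_val_le_1[of v] bin_val_le_1[of w] by simp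
next
  case (Suc n)
  have "\<bar>bin_val (\<lambda>n. v (Suc n)) - bin_val (\<lambda>n. w (Suc n))\<bar> \<le> 1 / 2 ^ n"
    using Suc.prems by (intro Suc.IH bin_seq_Suc) auto
  then show ?case
    using bin_val_head[OF Suc.prems(1)] bin_val_head[OF Suc.prems(2)] Suc.prems(3)[of 0]
    by (simp add: diff_divide_distrib[symmetric])
qed

section \<open>Sequences with few blocks\<close>

text \<open>The first \<open>K\<close> digits are unrestricted; from there on the sequence is cut
  into consecutive blocks of length \<open>M\<close>.\<close>

definition blocks_in :: "nat \<Rightarrow> nat \<Rightarrow> nat list set \<Rightarrow> (nat \<Rightarrow> nat) \<Rightarrow> bool" where
  "blocks_in M K W v \<longleftrightarrow> (\<forall>j. map (\<lambda>i. v (K + j * M + i)) [0..<M] \<in> W)"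

text \<open>Linearly many words of length \<open>M\<close> are negligible against
  \<open>2 ^ M\<close>. Restricting to multiples of \<open>p\<close> accommodates a period, and
  still lets two tame sequences share a block length, namely any multiple of the product of their
  \<open>p\<close>. Both \<open>K\<close> and \<open>W\<close> may depend on
  \<open>M\<close>.\<close>

definition tame :: "(nat \<Rightarrow> nat) \<Rightarrow> bool" where
  "tame v \<longleftrightarrow> (\<exists>p>0. \<forall>M>0. p dvd M \<longrightarrow>
     (\<exists>K W. finite W \<and> card W \<le> M + 1 \<and> blocks_in M K W v))"

lemma tame_complement:
  assumes "tame v"
  shows "tame (\<lambda>n. 1 - v n)"
proof -
  from assms obtain p where p: "p > 0" and
    *: "\<And>M. M > 0 \<Longrightarrow> p dvd M \<Longrightarrow> \<exists>K W. finite W \<and> card W \<le> M + 1 \<and> blocks_in M K W v"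
    unfolding tame_def by blast
  have "\<exists>K W. finite W \<and> card W \<le> M + 1 \<and> blocks_in M K W (\<lambda>n. 1 - v n)"
    if M: "M > 0" "p dvd M" for M
  proof -
    from *[OF M] obtain K W where W: "finite W" "card W \<le> M + 1" "blocks_in M K W v" by blast
    have "blocks_in M K (map (\<lambda>x. 1 - x) ` W) (\<lambda>n. 1 - v n)"
      unfolding blocks_in_def
    proof
      fix j
      show "map (\<lambda>i. 1 - v (K + j * M + i)) [0..<M] \<in> map (\<lambda>x. 1 - x) ` W"
        using W(3) unfolding blocks_in_def
        by (intro image_eqI[of _ _ "map (\<lambda>i. v (K + j * M + i)) [0..<M]"]) auto
    qed
    moreover have "card (map (\<lambda>x. 1 - x) ` W) \<le> M + 1"
      using card_image_le[OF W(1)] W(2) le_trans by blast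
    ultimately show ?thesis using W(1) by blast
  qed
  with p show ?thesis unfolding tame_def by blast
qed

text \<open>When the period divides \<open>M\<close>, all blocks beyond the preperiod coincide, so
  one word suffices.\<close>

lemma tame_if_periodic:
  assumes p: "p > 0" and per: "\<And>n. n \<ge> K \<Longrightarrow> v (n + p) = v n"
  shows "tame v"
proof -
  have mult: "v (n + k * p) = v n" if "n \<ge> K" for n k
  proof (induction k)
    case (Suc k)
    then show ?case using per[of "n + k * p"] that by (simp add: algebra_simps)
  qed simp
  have "blocks_in M K {map (\<lambda>i. v (K + i)) [0..<M]} v" if "p dvd M" for M
    unfolding blocks_in_def
  proof
    fix j
    from that obtain c where c: "M = p * c" by (auto elim: dvdE)
    have "v (K + j * M + i) = v (K + i)" for i
      using mult[of "K + i" "j * c"] by (simp add: c algebra_simps)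
    then show "map (\<lambda>i. v (K + j * M + i)) [0..<M] \<in> {map (\<lambda>i. v (K + i)) [0..<M]}" by simp
  qed
  then show ?thesis
    unfolding tame_def using p
    by (intro exI[of _ p] conjI allI impI exI[of _ K]
        exI[of _ "{map (\<lambda>i. v (K + i)) [0..<_]}"]) auto
qed

text \<open>Far enough out, a block of length \<open>M\<close> contains at most one 0, which leaves
  \<open>M + 1\<close> words; every \<open>M\<close> works, so \<open>p = 1\<close>.\<close>

lemma tame_if_sparse:
  assumes v: "bin_seq v"
    and sparse: "\<And>M. \<exists>K. \<forall>m n. K \<le> m \<and> m < n \<and> n < m + M \<and> v m = 0 \<longrightarrow> v n = 1"
  shows "tame v"
proof -
  have "\<exists>K W. finite W \<and> card W \<le> M + 1 \<and> blocks_in M K W v" for M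
  proof -
    obtain K where K: "\<And>m n. K \<le> m \<Longrightarrow> m < n \<Longrightarrow> n < m + M \<Longrightarrow> v m = 0 \<Longrightarrow> v n = 1"
      using sparse[of M] by blast
    \<comment> \<open>The index \<open>i = M\<close> lies beyond the list, so that update changes
      nothing and yields the all-ones word.\<close>
    define W where "W = (\<lambda>i. (replicate M (1::nat))[i := 0]) ` {..M}"
    have "map (\<lambda>i. v (K + j * M + i)) [0..<M] \<in> W" for j
    proof (cases "\<exists>i<M. v (K + j * M + i) = 0")
      case True
      then obtain i where i: "i < M" "v (K + j * M + i) = 0" by blast
      have ones: "v (K + j * M + i') = 1" if "i' < M" "i' \<noteq> i" for i'
      proof (cases "i < i'")
        case True
        then show ?thesis using K[of "K + j * M + i" "K + j * M + i'"] i that by simp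
      next
        case False
        then have "v (K + j * M + i') \<noteq> 0"
          using K[of "K + j * M + i'" "K + j * M + i"] i that by auto
        then show ?thesis using bin_seqD[OF v, of "K + j * M + i'"] by auto
      qed
      have "map (\<lambda>i. v (K + j * M + i)) [0..<M] = (replicate M 1)[i := 0]"
        using i ones by (intro nth_equalityI) (auto simp: nth_list_update)
      then show ?thesis using i unfolding W_def by auto
    next
      case False
      then have "v (K + j * M + i) = 1" if "i < M" for i
        using bin_seqD[OF v, of "K + j * M + i"] that by blast
      then have "map (\<lambda>i. v (K + j * M + i)) [0..<M] = (replicate M 1)[M := 0]"
        by (intro nth_equalityI) auto
      then show ?thesis unfolding W_def by blast
    qed
    then have "blocks_in M K W v" by (simp add: blocks_in_def)
    moreover have "card W \<le> M + 1"
      unfolding W_def using card_image_le[of "{..M}"] by simp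
    moreover have "finite W" by (simp add: W_def)
    ultimately show ?thesis by blast
  qed
  then show ?thesis unfolding tame_def by (intro exI[of _ 1]) auto
qed

text \<open>From \<open>t\<close> on, \<open>c\<close> occurs exactly at the places
  \<open>t + k * p\<close>. Elsewhere both digits differ from \<open>c\<close>, and over two letters
  they therefore agree.\<close>

lemma periodic_if_equal_gaps:
  assumes v: "bin_seq v" and p: "p > 0" and t: "v t = c"
    and gap: "\<And>n. n \<ge> t \<Longrightarrow> v n = c \<Longrightarrow> v (n + p) = c \<and> (\<forall>i. 0 < i \<and> i < p \<longrightarrow> v (n + i) \<noteq> c)"
    and n: "n \<ge> t"
  shows "v (n + p) = v n"
proof -
  have c: "v (t + k * p) = c" for k
  proof (induction k)
    case (Suc k)
    then show ?case using gap[of "t + k * p"] by (simp add: algebra_simps)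
  qed (simp add: t)
  define k i where "k = (n - t) div p" and "i = (n - t) mod p"
  have "n - t = k * p + i" by (simp add: k_def i_def)
  then have n_eq: "n = t + k * p + i" using n by simp
  have ip: "i < p" using p by (simp add: i_def)
  show ?thesis
  proof (cases "i = 0")
    case True
    then show ?thesis using c[of k] c[of "Suc k"] n_eq by (simp add: algebra_simps)
  next
    case False
    have "v (t + k * p + i) \<noteq> c" "v (t + Suc k * p + i) \<noteq> c"
      using gap[OF _ c[of k]] gap[OF _ c[of "Suc k"]] False ip by auto
    moreover have "t + Suc k * p + i = n + p" using n_eq by simp
    ultimately have "v n \<noteq> c" "v (n + p) \<noteq> c" using n_eq by metis+
    then show ?thesis using bin_seqD[OF v, of n] bin_seqD[OF v, of "n + p"] bin_seqD[OF v, of t] t by auto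
  qed
qed

section \<open>Monotone runs\<close>

text \<open>By \<open>step\<close>, a lower bound \<open>a\<close> on the run of ones before a zero
  passes on to all later zeros; the pair 11 at \<open>k\<close> starts this with
  \<open>a = 2\<close>. If the bounds grow without limit, zeros become sparse. Otherwise the largest
  bound is eventually the exact length of every run, and the sequence is eventually
  periodic.\<close>

lemma tame_if_ones_runs_increase:
  assumes v: "bin_seq v"
    and zeros: "\<And>n. \<exists>m\<ge>n. v m = 0"
    and step: "\<And>a t. 2 \<le> a \<Longrightarrow> N + a \<le> t \<Longrightarrow> v t = 0 \<Longrightarrow> (\<forall>n. t - a \<le> n \<and> n < t \<longrightarrow> v n = 1) \<Longrightarrow>
      (\<forall>n. t < n \<and> n \<le> t + a \<longrightarrow> v n = 1)"
    and k: "N \<le> k" "v k = 1" "v (Suc k) = 1"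
  shows "tame v"
proof -
  \<comment> \<open>At least \<open>a\<close> ones precede the zero at \<open>t\<close>, possibly
    more; the run starts no earlier than \<open>N\<close>, as \<open>step\<close> demands.\<close>
  define S where "S a t \<longleftrightarrow> N + a \<le> t \<and> v t = 0 \<and> (\<forall>n. t - a \<le> n \<and> n < t \<longrightarrow> v n = 1)" for a t
  have not0: "v n = 1" if "v n \<noteq> 0" for n using bin_seqD[OF v, of n] that by blast
  have next_zero: "\<exists>z>n. v z = 0 \<and> (\<forall>i. n < i \<and> i < z \<longrightarrow> v i = 1)" for n
  proof -
    define z where "z = (LEAST z. n < z \<and> v z = 0)"
    have "\<exists>z. n < z \<and> v z = 0" using zeros[of "Suc n"] by (auto simp: Suc_le_eq)
    then have "n < z \<and> v z = 0" unfolding z_def by (rule LeastI_ex)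
    moreover have "v i = 1" if "n < i" "i < z" for i
      using not_less_Least[of i "\<lambda>z. n < z \<and> v z = 0"] that not0 by (auto simp: z_def)
    ultimately show ?thesis by blast
  qed
  have S_step: "v n = 1" if "2 \<le> a" "S a t" "t < n" "n \<le> t + a" for a t n
    using step[OF that(1)] that unfolding S_def by blast
  \<comment> \<open>Strong induction along the zeros: the last zero \<open>z\<close> before
    \<open>t'\<close> satisfies \<open>S a z\<close>, so \<open>a\<close> ones follow it. Hence
    \<open>t' > z + a\<close>, and all digits strictly between are ones.\<close>
  have S_next: "S a t'" if a: "2 \<le> a" and S: "S a t" and t': "t \<le> t'" "v t' = 0" for a t t'
    using t'
  proof (induction t' rule: less_induct)
    case (less t')
    show ?case
    proof (cases "t' = t")
      case False
      define Z where "Z = {z. t \<le> z \<and> z < t' \<and> v z = 0}"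
      have "finite Z" by (rule finite_subset[of _ "{..t'}"]) (auto simp: Z_def)
      have "t \<in> Z" using S less.prems False by (auto simp: Z_def S_def)
      define z where "z = Max Z"
      have "z \<in> Z" unfolding z_def using \<open>finite Z\<close> \<open>t \<in> Z\<close> by (intro Max_in) auto
      then have z: "t \<le> z" "z < t'" "v z = 0" by (auto simp: Z_def)
      have ones: "v n = 1" if "z < n" "n < t'" for n
      proof (rule not0, rule notI)
        assume "v n = 0"
        then have "n \<in> Z" using that z by (simp add: Z_def)
        then have "n \<le> z" unfolding z_def using \<open>finite Z\<close> by (intro Max_ge)
        then show False using that by simp
      qed
      have Sz: "S a z" using less.IH[of z] z by blast
      have "\<not> t' \<le> z + a" using S_step[OF a Sz, of t'] z less.prems by auto
      then show ?thesis using ones Sz less.prems unfolding S_def by auto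
    qed (use S in simp)
  qed
  obtain t0 where t0: "t0 > Suc k" "v t0 = 0" "\<And>i. Suc k < i \<Longrightarrow> i < t0 \<Longrightarrow> v i = 1"
    using next_zero[of "Suc k"] by blast
  have "v n = 1" if "t0 - 2 \<le> n" "n < t0" for n
    using t0 k that by (cases "n = k"; cases "n = Suc k") auto
  then have S2: "S 2 t0" using t0 k unfolding S_def by auto
  show ?thesis
  proof (cases "\<forall>a\<ge>2. \<exists>t. S a t")
    case True
    show ?thesis
    proof (rule tame_if_sparse[OF v])
      fix M :: nat
      \<comment> \<open>\<open>M + 2\<close> instead of \<open>M\<close> keeps the length at least
        2, as \<open>S_next\<close> requires. Two later zeros less than \<open>M\<close> apart would
        contradict the run before the second one.\<close>
      obtain t where t: "S (M + 2) t" using True by (meson le_add2)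
      have "v n = 1" if "t \<le> m" "m < n" "n < m + M" "v m = 0" for m n
      proof (rule not0, rule notI)
        assume "v n = 0"
        then have "S (M + 2) n" using S_next[OF _ t, of n] that by simp
        then show False using that unfolding S_def by auto
      qed
      then show "\<exists>K. \<forall>m n. K \<le> m \<and> m < n \<and> n < m + M \<and> v m = 0 \<longrightarrow> v n = 1" by blast
    qed
  next
    case False
    \<comment> \<open>The least length that never occurs. Since \<open>S 2 t0\<close> holds, its
      predecessor \<open>a\<close> is still at least 2 and does occur.\<close>
    define a' where "a' = (LEAST a. 2 \<le> a \<and> (\<forall>t. \<not> S a t))"
    have a': "2 \<le> a' \<and> (\<forall>t. \<not> S a' t)"
      unfolding a'_def by (rule LeastI_ex) (use False in blast)
    have "a' \<noteq> 2" using a' S2 by blast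
    define a where "a = a' - 1"
    have a: "2 \<le> a" "a' = Suc a" using a' \<open>a' \<noteq> 2\<close> by (auto simp: a_def)
    obtain t where t: "S a t"
      using not_less_Least[of a "\<lambda>a. 2 \<le> a \<and> (\<forall>t. \<not> S a t)"] a by (auto simp: a'_def[symmetric])
    have gap: "v (n + Suc a) = 0 \<and> (\<forall>i. 0 < i \<and> i < Suc a \<longrightarrow> v (n + i) \<noteq> 0)"
      if n: "t \<le> n" "v n = 0" for n
    proof -
      have Sn: "S a n" using S_next[OF a(1) t n] .
      have ones: "v m = 1" if "n < m" "m \<le> n + a" for m
        using S_step[OF a(1) Sn that] .
      \<comment> \<open>If the run after \<open>n\<close> were longer than \<open>a\<close>, the
        zero ending it would witness \<open>S (Suc a)\<close>, a length that never occurs. So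
        consecutive zeros are exactly \<open>a + 1\<close> apart.\<close>
      have "v (n + Suc a) = 0"
      proof (rule ccontr)
        assume 1: "v (n + Suc a) \<noteq> 0"
        obtain z where z: "n < z" "v z = 0" "\<And>i. n < i \<Longrightarrow> i < z \<Longrightarrow> v i = 1"
          using next_zero[of n] by blast
        have "\<not> z \<le> n + a" using ones z by force
        with 1 z(2) have "n + Suc a < z" by (cases "z = n + Suc a") auto
        then have "S a' z" using z Sn unfolding S_def a(2) by auto
        then show False using a' by blast
      qed
      then show ?thesis using ones by simp
    qed
    have "v t = 0" using t by (simp add: S_def)
    show ?thesis
    proof (rule tame_if_periodic[of "Suc a" t])
      show "v (n + Suc a) = v n" if "n \<ge> t" for n
        by (rule periodic_if_equal_gaps[OF v _ \<open>v t = 0\<close> gap that]) simp_all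
    qed simp
  qed
qed

text \<open>By \<open>step\<close> and \<open>no11\<close>, gaps between consecutive ones beyond
  \<open>N\<close> never increase. Natural numbers cannot decrease forever, so from the place where
  the least gap is attained all gaps equal it, and the sequence is eventually periodic.\<close>

lemma tame_if_zeros_runs_decrease:
  assumes v: "bin_seq v"
    and ones: "\<And>n. \<exists>m\<ge>n. v m = 1"
    and step: "\<And>b m. 2 \<le> b \<Longrightarrow> N \<le> m \<Longrightarrow> v m = 1 \<Longrightarrow> (\<forall>n. m < n \<and> n \<le> m + b \<longrightarrow> v n = 0) \<Longrightarrow>
      (\<forall>n. n < m \<and> m \<le> n + b \<longrightarrow> v n = 0)"
    and no11: "\<And>k. N \<le> k \<Longrightarrow> v k = 1 \<Longrightarrow> v (Suc k) = 0"
  shows "tame v"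
proof -
  \<comment> \<open>\<open>g\<close> is the distance from the one at \<open>m\<close> to the next
    one, so the run of zeros between them has length \<open>g - 1\<close>.\<close>
  define G where "G m g \<longleftrightarrow> N \<le> m \<and> v m = 1 \<and> g > 0 \<and> v (m + g) = 1 \<and>
    (\<forall>i. 0 < i \<and> i < g \<longrightarrow> v (m + i) = 0)" for m g
  have not1: "v n = 0" if "v n \<noteq> 1" for n using bin_seqD[OF v, of n] that by blast
  have next_one: "\<exists>g. G m g" if "N \<le> m" "v m = 1" for m
  proof -
    define g where "g = (LEAST g. 0 < g \<and> v (m + g) = 1)"
    obtain n where "n \<ge> Suc m" "v n = 1" using ones by blast
    then have "\<exists>g. 0 < g \<and> v (m + g) = 1" by (intro exI[of _ "n - m"]) auto
    then have "0 < g \<and> v (m + g) = 1" unfolding g_def by (rule LeastI_ex)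
    moreover have "v (m + i) = 0" if "0 < i" "i < g" for i
      using not_less_Least[of i "\<lambda>g. 0 < g \<and> v (m + g) = 1"] that not1 by (auto simp: g_def)
    ultimately show ?thesis using that unfolding G_def by blast
  qed
  define g where "g = (LEAST g. \<exists>m. G m g)"
  have "\<exists>g m. G m g" using ones[of N] next_one by blast
  then have "\<exists>m. G m g" unfolding g_def by (rule LeastI_ex)
  then obtain m where m: "G m g" by blast
  have g_min: "g \<le> g'" if "G n g'" for n g' unfolding g_def using that by (intro Least_le) blast
  have all: "G n g" if "m \<le> n" "v n = 1" for n
    using that
  proof (induction n rule: less_induct)
    case (less n)
    show ?case
    proof (cases "n = m")
      case False
      \<comment> \<open>The last one \<open>z\<close> before \<open>n\<close> has gap
        \<open>g\<close> by induction. The next one after \<open>z\<close> is then \<open>n\<close>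
        itself, so \<open>n = z + g\<close>.\<close>
      define Z where "Z = {z. m \<le> z \<and> z < n \<and> v z = 1}"
      have "finite Z" by (rule finite_subset[of _ "{..n}"]) (auto simp: Z_def)
      have "m \<in> Z" using m less.prems False by (auto simp: Z_def G_def)
      define z where "z = Max Z"
      have "z \<in> Z" unfolding z_def using \<open>finite Z\<close> \<open>m \<in> Z\<close> by (intro Max_in) auto
      then have z: "m \<le> z" "z < n" "v z = 1" by (auto simp: Z_def)
      have Gz: "G z g" using less.IH[of z] z by blast
      have "\<not> z + g < n"
      proof
        assume "z + g < n"
        then have "z + g \<in> Z" using z Gz by (auto simp: Z_def G_def)
        then have "z + g \<le> z" unfolding z_def using \<open>finite Z\<close> by (intro Max_ge)
        then show False using Gz by (simp add: G_def)
      qed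
      moreover have "\<not> n < z + g"
      proof
        assume "n < z + g"
        then have "v (z + (n - z)) = 0" using Gz z unfolding G_def
            by (metis add_less_imp_less_left less_imp_le_nat le_add_diff_inverse zero_less_diff)
        then show False using z less.prems by simp
      qed
      ultimately have n_eq: "n = z + g" by simp
      have "N \<le> n" using m less.prems by (simp add: G_def)
      then obtain g' where g': "G n g'" using next_one less.prems by blast
      \<comment> \<open>A larger gap puts at least \<open>g\<close> zeros after \<open>n\<close>.
        For \<open>g >= 2\<close>, \<open>step\<close> would force zeros on the \<open>g\<close>
        places before \<open>n\<close>, including \<open>z\<close>, where there is a 1. For
        \<open>g = 1\<close>, \<open>z\<close> and \<open>n\<close> would form the pair 11.\<close>
      have "\<not> g < g'"
      proof
        assume lt: "g < g'"
        show False
        proof (cases "g = 1")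
          case True
          then show False using no11[of z] Gz n_eq less.prems by (simp add: G_def)
        next
          case False
          then have "2 \<le> g" using Gz by (simp add: G_def)
          moreover have "\<forall>i. n < i \<and> i \<le> n + g \<longrightarrow> v i = 0"
          proof (intro allI impI)
            fix i assume "n < i \<and> i \<le> n + g"
            then show "v i = 0" using g' lt unfolding G_def
              by (metis add_diff_inverse_nat add_le_cancel_left le_less_trans less_imp_not_less zero_less_diff)
          qed
          ultimately have "v z = 0"
            using step[of g n] \<open>N \<le> n\<close> less.prems n_eq z by auto
          then show False using z by simp
        qed
      qed
      then have "g' = g" using g_min[OF g'] by simp
      then show ?thesis using g' by simp
    qed (use m in simp)
  qed
  have gap: "v (n + g) = 1 \<and> (\<forall>i. 0 < i \<and> i < g \<longrightarrow> v (n + i) \<noteq> 1)" if "m \<le> n" "v n = 1" for n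
    using all[OF that] unfolding G_def by auto
  have "v m = 1" "g > 0" using m by (auto simp: G_def)
  then show ?thesis
    using tame_if_periodic[of g m v] periodic_if_equal_gaps[OF v _ _ gap] by blast
qed

section \<open>Sequences avoiding the hole\<close>

text \<open>The four inequalities are the sides of the quadrilateral. They cut out an open set
  inside the hull, hence inside its interior.\<close>

lemma Delta_superset:
  assumes "0 < x" "y < 1" "(1 + x) / 2 < y" "2 * x < y"
  shows "(x, y) \<in> Delta"
proof -
  define D where "D = {p :: real \<times> real. 0 < fst p} \<inter> {p. snd p < 1} \<inter>
    {p. (1 + fst p) / 2 < snd p} \<inter> {p. 2 * fst p < snd p}"
  have "open D"
    unfolding D_def by (intro open_Int open_Collect_less continuous_intros) auto
  moreover have "D \<subseteq> convex hull {(0, 1), (1/2, 1), (1/3, 2/3), (0, 1/2)}"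
  proof
    fix p assume "p \<in> D"
    then obtain x y where p: "p = (x, y)" and
      xy: "0 < x" "y < 1" "(1 + x) / 2 < y" "2 * x < y"
      by (cases p) (auto simp: D_def)
    show "p \<in> convex hull {(0, 1), (1/2, 1), (1/3, 2/3), (0, 1/2)}"
    \<comment> \<open>The diagonal from (0,1) to (1/3,2/3) lies on \<open>x + y = 1\<close> and cuts
      the quadrilateral into two triangles; the coefficients below are barycentric coordinates in
      each.\<close>
    proof (cases "1 - x \<le> y")
      case True
      have "p = (y - 2 * x) *\<^sub>R (0, 1) + (2 * (x + y - 1)) *\<^sub>R (1/2, 1) + (3 * (1 - y)) *\<^sub>R (1/3, 2/3)"
        unfolding p by (simp add: algebra_simps)
      then have "p \<in> convex hull {(0, 1), (1/2, 1), (1/3, 2/3)}"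
        unfolding convex_hull_3 using xy True
        by (intro CollectI exI[of _ "y - 2 * x"] exI[of _ "2 * (x + y - 1)"] exI[of _ "3 * (1 - y)"])
          auto
      then show ?thesis by (rule rev_subsetD) (intro hull_mono; auto)
    next
      case False
      have "p = (2 * y - 1 - x) *\<^sub>R (0, 1) + (3 * x) *\<^sub>R (1/3, 2/3) + (2 * (1 - y - x)) *\<^sub>R (0, 1/2)"
        unfolding p by (simp add: algebra_simps)
      then have "p \<in> convex hull {(0, 1), (1/3, 2/3), (0, 1/2)}"
        unfolding convex_hull_3 using xy False
        by (intro CollectI exI[of _ "2 * y - 1 - x"] exI[of _ "3 * x"] exI[of _ "2 * (1 - y - x)"])
          auto
      then show ?thesis by (rule rev_subsetD) (intro hull_mono; auto)
    qed
  qed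
  ultimately have "D \<subseteq> Delta"
    unfolding Delta_def by (rule interior_maximal[rotated])
  moreover have "(x, y) \<in> D" using assms by (simp add: D_def)
  ultimately show ?thesis by blast
qed

lemma Delta_subset_unit_square: "Delta \<subseteq> unit_square"
proof -
  have "convex unit_square" unfolding unit_square_def by (intro convex_Times) auto
  then have "convex hull {(0, 1), (1/2, 1), (1/3, 2/3), (0, 1/2)} \<subseteq> unit_square"
    by (intro hull_minimal) (auto simp: unit_square_def)
  then show ?thesis unfolding Delta_def using interior_subset by blast
qed

section \<open>One-sided halves of a sequence and the reflection of the hole\<close>

definition right_half :: "(int \<Rightarrow> nat) \<Rightarrow> nat \<Rightarrow> nat" where
  "right_half u = (\<lambda>n. u (int n + 1))"

definition left_half :: "(int \<Rightarrow> nat) \<Rightarrow> nat \<Rightarrow> nat" where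
  "left_half u = (\<lambda>n. u (- int n))"

lemma coding_eq: "coding u = (bin_val (right_half u), bin_val (left_half u))"
  by (simp add: coding_def bin_val_def right_half_def left_half_def)

lemma bin_seq_halves:
  assumes "u \<in> binary_seqs"
  shows "bin_seq (right_half u)" "bin_seq (left_half u)"
  using assms by (auto simp: binary_seqs_def bin_seq_def right_half_def left_half_def)

lemma shift_binary_seqs: "u \<in> binary_seqs \<Longrightarrow> shift n u \<in> binary_seqs"
  by (simp add: binary_seqs_def shift_def)

text \<open>The symmetry \<open>(x, y) \<mapsto> (1 - y, 1 - x)\<close> of the hole, on the level of sequences.\<close>

definition flip :: "(int \<Rightarrow> nat) \<Rightarrow> int \<Rightarrow> nat" where
  "flip u = (\<lambda>k. 1 - u (1 - k))"

lemma flip_binary_seqs: "flip u \<in> binary_seqs"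
  by (auto simp: binary_seqs_def flip_def)

lemma left_half_eq_flip:
  assumes "u \<in> binary_seqs"
  shows "left_half u = (\<lambda>n. 1 - right_half (flip u) n)"
proof
  fix n
  have "u (- int n) \<in> {0, 1}" using assms by (simp add: binary_seqs_def)
  then show "left_half u n = 1 - right_half (flip u) n"
    by (auto simp: left_half_def right_half_def flip_def)
qed

text \<open>The hole expressed by its four side inequalities, ready for linear arithmetic; survivors
  of \<open>Delta\<close> satisfy this by \<open>Delta_superset\<close>.\<close>

definition avoids :: "(int \<Rightarrow> nat) \<Rightarrow> bool" where
  "avoids u \<longleftrightarrow> (\<forall>n x y. coding (shift n u) = (x, y) \<longrightarrow>
     \<not> (0 < x \<and> y < 1 \<and> (1 + x) / 2 < y \<and> 2 * x < y))"

text \<open>Flipping reverses time and maps a point (x,y) to (1-y,1-x). This exchanges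
  \<open>0 < x\<close> with \<open>y < 1\<close>, and \<open>(1 + x) / 2 < y\<close> with
  \<open>2 * x < y\<close>.\<close>

lemma avoids_flip:
  assumes u: "u \<in> binary_seqs" and "avoids u"
  shows "avoids (flip u)"
proof -
  have "coding (shift n (flip u)) =
      (1 - snd (coding (shift (- n) u)), 1 - fst (coding (shift (- n) u)))" for n
  proof -
    define w where "w = shift (- n) u"
    have w: "w \<in> binary_seqs" unfolding w_def by (rule shift_binary_seqs[OF u])
    have "right_half (shift n (flip u)) = (\<lambda>k. 1 - left_half w k)"
      and "left_half (shift n (flip u)) = (\<lambda>k. 1 - right_half w k)"
      unfolding fun_eq_iff right_half_def left_half_def shift_def flip_def w_def
      by (auto intro!: arg_cong[where f = "\<lambda>k. Suc 0 - u k"])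
    then show ?thesis
      unfolding coding_eq w_def[symmetric]
      using bin_val_complement[OF bin_seq_halves(1)[OF w]] bin_val_complement[OF bin_seq_halves(2)[OF w]]
      by simp
  qed
  moreover have "\<not> (0 < 1 - y \<and> 1 - x < 1 \<and> (1 + (1 - y)) / 2 < 1 - x \<and> 2 * (1 - y) < 1 - x)"
    if "coding (shift n u) = (x, y)" for n x y
    using assms(2) that unfolding avoids_def by (fastforce simp: field_simps)
  ultimately show ?thesis
    unfolding avoids_def by (metis fst_conv snd_conv surj_pair)
qed

text \<open>Two positions of the dot next to an occurrence of 10 turn avoidance of the hole into the
  two run conditions; the lemmas on monotone runs then apply.\<close>

lemma tame_right_half:
  assumes u: "u \<in> binary_seqs" and avoids: "avoids u"
  shows "tame (right_half u)"
proof -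
  define v where "v = right_half u"
  have v: "bin_seq v" unfolding v_def by (rule bin_seq_halves(1)[OF u])
  have ub: "u k = 0 \<or> u k = 1" for k using u by (auto simp: binary_seqs_def)
  \<comment> \<open>The two digit sequences seen from the dot after place \<open>k\<close>. For
    \<open>k = t\<close>, the first digit to the right is \<open>v t\<close> and the first to the
    left is \<open>v (t - 1)\<close>.\<close>
  define R where "R k = (\<lambda>i. u (k + int i + 1))" for k
  define L where "L k = (\<lambda>i. u (k - int i))" for k
  have R: "bin_seq (R k)" and L: "bin_seq (L k)" for k
    using u by (auto simp: R_def L_def bin_seq_def binary_seqs_def)
  have "right_half (shift k u) = R k" "left_half (shift k u) = L k" for k
    by (simp_all add: fun_eq_iff right_half_def left_half_def shift_def R_def L_def algebra_simps)
  then have "coding (shift k u) = (bin_val (R k), bin_val (L k))" for k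
    by (simp add: coding_eq)
  then have hit: "\<not> (0 < bin_val (R k) \<and> bin_val (L k) < 1 \<and>
      (1 + bin_val (R k)) / 2 < bin_val (L k) \<and> 2 * bin_val (R k) < bin_val (L k))" for k
    using avoids unfolding avoids_def by blast
  have RSuc: "(\<lambda>i. R k (Suc i)) = R (k + 1)" and LSuc: "(\<lambda>i. L k (Suc i)) = L (k - 1)" for k
    by (simp_all add: R_def L_def fun_eq_iff algebra_simps)
  have Rv: "R (int t) i = v (t + i)" for t i
    by (simp add: R_def v_def right_half_def)
  have Lv: "L (int t) i = v (t - 1 - i)" if "i < t" for t i
    using that by (simp add: L_def v_def right_half_def of_nat_diff)
  show ?thesis
  proof (cases "\<exists>K c. \<forall>n\<ge>K. v n = c")
    case True
    then obtain K c where "\<And>n. n \<ge> K \<Longrightarrow> v n = c" by blast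
    then show ?thesis using tame_if_periodic[of 1 K v] unfolding v_def by simp
  next
    case False
    have zeros: "\<exists>m\<ge>n. v m = 0" and ones: "\<exists>m\<ge>n. v m = 1" for n
      using False bin_seqD[OF v] by metis+
    obtain z0 z1 where z: "v z0 = 0" "v z1 = 1" using zeros ones by metis
    \<comment> \<open>From here on the past contains both a 0 and a 1, which makes the bounds on
      \<open>L\<close> strict; \<open>+ 2\<close> leaves room for the index shifts.\<close>
    define N where "N = z0 + z1 + 2"
    have L_less_1: "bin_val (L (int t)) < 1" if "z0 < t" for t
      using that z(1) Lv[of "t - 1 - z0" t] by (intro bin_val_less_1[OF L, of _ "t - 1 - z0"]) simp
    have L_pos: "0 < bin_val (L (int t))" if "z1 < t" for t
      using that z(2) Lv[of "t - 1 - z1" t] by (intro bin_val_pos[OF L, of _ "t - 1 - z1"]) simp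
    have R_less_1: "bin_val (R (int t)) < 1" for t
    proof -
      obtain m where "m \<ge> t" "v m = 0" using zeros by blast
      then show ?thesis using Rv[of t "m - t"] by (intro bin_val_less_1[OF R, of _ "m - t"]) simp
    qed
    have R_pos: "0 < bin_val (R (int t))" for t
    proof -
      obtain m where "m \<ge> t" "v m = 1" using ones by blast
      then show ?thesis using Rv[of t "m - t"] by (intro bin_val_pos[OF R, of _ "m - t"]) simp
    qed
    \<comment> \<open>With the dot just before the zero, \<open>y\<close> begins with
      \<open>a\<close> ones, so \<open>y > 1 - 1 / 2 ^ a >= 3/4\<close>, while
      \<open>x < 1/2\<close>. Only \<open>2 * x < y\<close> can fail, so
      \<open>y \<le> 2 * x\<close>. As \<open>2 * x\<close> is the value of the digits after the
      zero, these begin with \<open>a\<close> ones.\<close>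
    have step1: "\<forall>n. t < n \<and> n \<le> t + a \<longrightarrow> v n = 1"
      if a: "2 \<le> a" and t: "N + a \<le> t" "v t = 0" and run: "\<forall>n. t - a \<le> n \<and> n < t \<longrightarrow> v n = 1" for a t
    proof -
      have "(\<lambda>n. L (int t) (n + a)) = L (int (t - a))"
        using t by (simp add: L_def fun_eq_iff of_nat_diff algebra_simps)
      moreover have "L (int t) i = 1" if "i < a" for i
        using Lv[of i t] run t that by simp
      ultimately have "bin_val (L (int t)) = 1 - (1 - bin_val (L (int (t - a)))) / 2 ^ a"
        using bin_val_ones[OF L, of a "int t"] by simp
      moreover have "0 < bin_val (L (int (t - a)))" using t by (intro L_pos) (simp add: N_def)
      ultimately have big: "1 - 1 / 2 ^ a < bin_val (L (int t))" by (simp add: field_simps)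
      have "(2::real) ^ 2 \<le> 2 ^ a" using a by (intro power_increasing) auto
      then have "(1::real) / 2 ^ a \<le> 1 / 4" by (simp add: field_simps)
      with big have "3 / 4 < bin_val (L (int t))" by linarith
      moreover have "bin_val (R (int t)) = bin_val (R (int t + 1)) / 2"
        using bin_val_head[OF R, of "int t"] Rv[of t 0] t(2) by (simp add: RSuc)
      moreover have "bin_val (R (int t + 1)) < 1" using R_less_1[of "Suc t"] by (simp add: add.commute)
      moreover have "bin_val (L (int t)) < 1" using t by (intro L_less_1) (simp add: N_def)
      ultimately have "bin_val (L (int t)) \<le> bin_val (R (int t + 1))"
        using hit[of "int t"] R_pos[of t] by argo
      with big have "1 - 1 / 2 ^ a < bin_val (R (int (Suc t)))" by (simp add: add.commute)
      then have *: "v (Suc t + i) = 1" if "i < a" for i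
        using ones_if_bin_val_greater[OF R _ that, of "int (Suc t)"] Rv[of "Suc t" i] by simp
      show ?thesis
      proof (intro allI impI)
        fix n assume "t < n \<and> n \<le> t + a"
        then have "n - Suc t < a" "Suc t + (n - Suc t) = n" by auto
        then show "v n = 1" using *[of "n - Suc t"] by metis
      qed
    qed
    \<comment> \<open>With the dot just after the one, \<open>X < 1 / 2 ^ b \<le> 1/4\<close> and
      \<open>Y > 1/2 > 2 * X\<close>. Only \<open>(1 + X) / 2 < Y\<close> can fail. Since
      \<open>Y\<close> is 1/2 plus half the value of the digits before the one, that value is at
      most \<open>X\<close>, so \<open>b\<close> zeros precede the one.\<close>
    have step2: "\<forall>n. n < m \<and> m \<le> n + b \<longrightarrow> v n = 0"
      if b: "2 \<le> b" and m: "N \<le> m" "v m = 1" and run: "\<forall>n. m < n \<and> n \<le> m + b \<longrightarrow> v n = 0" for b m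
    proof -
      define X Y where "X = bin_val (R (int (Suc m)))" and "Y = bin_val (L (int (Suc m)))"
      have "bin_val (R (int (Suc m))) = bin_val (\<lambda>n. R (int (Suc m)) (n + b)) / 2 ^ b"
        using run by (intro bin_val_zeros[OF R]) (simp only: Rv, auto)
      moreover have "(\<lambda>n. R (int (Suc m)) (n + b)) = R (int (Suc m + b))"
        by (simp add: R_def fun_eq_iff algebra_simps)
      ultimately have small: "X < 1 / 2 ^ b"
        using R_less_1[of "Suc m + b"] by (simp add: X_def field_simps)
      have "(2::real) ^ 2 \<le> 2 ^ b" using b by (intro power_increasing) auto
      then have "(1::real) / 2 ^ b \<le> 1 / 4" by (simp add: field_simps)
      with small have "X < 1 / 4" by linarith
      moreover have Y: "Y = (1 + bin_val (L (int m))) / 2"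
        using bin_val_head[OF L, of "int (Suc m)"] Lv[of 0 "Suc m"] m(2) by (simp add: LSuc Y_def)
      moreover have "0 < bin_val (L (int m))" using m by (intro L_pos) (simp add: N_def)
      moreover have "Y < 1" unfolding Y_def using m by (intro L_less_1) (simp add: N_def)
      moreover have "0 < X" unfolding X_def by (rule R_pos)
      ultimately have "bin_val (L (int m)) \<le> X"
        using hit[of "int (Suc m)", folded X_def Y_def] by argo
      with small have small_L: "bin_val (L (int m)) < 1 / 2 ^ b" by linarith
      show ?thesis
      proof (intro allI impI)
        fix n assume n: "n < m \<and> m \<le> n + b"
        then have "L (int m) (m - 1 - n) = 0"
          by (intro zeros_if_bin_val_less[OF L small_L]) linarith
        then show "v n = 0" using Lv[of "m - 1 - n" m] n by simp
      qed
    qed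
    show ?thesis
    \<comment> \<open>A late pair 11 starts growing runs of ones; otherwise late ones are
      isolated.\<close>
    proof (cases "\<exists>k\<ge>N. v k = 1 \<and> v (Suc k) = 1")
      case True
      then show ?thesis
        using tame_if_ones_runs_increase[OF v zeros step1] unfolding v_def by blast
    next
      case False
      then have "v (Suc k) = 0" if "N \<le> k" "v k = 1" for k
        using bin_seqD[OF v, of "Suc k"] that by blast
      then show ?thesis
        using tame_if_zeros_runs_decrease[OF v ones step2] unfolding v_def by blast
    qed
  qed
qed

lemma tame_left_half:
  assumes "u \<in> binary_seqs" and "avoids u"
  shows "tame (left_half u)"
  unfolding left_half_eq_flip[OF assms(1)]
  by (intro tame_complement tame_right_half flip_binary_seqs avoids_flip assms)

section \<open>Counting\<close>

text \<open>Both coordinates use the same block length \<open>M\<close>, so that their prefixes can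
  be refined at the same rate.\<close>

definition block_piece where
  "block_piece M K W K' W' = {(bin_val v, bin_val w) | v w.
     bin_seq v \<and> bin_seq w \<and> blocks_in M K W v \<and> blocks_in M K' W' w}"

definition prefix_data :: "nat \<Rightarrow> nat \<Rightarrow> nat \<Rightarrow> (nat \<Rightarrow> nat) \<Rightarrow> nat list \<times> nat list list" where
  "prefix_data M K q v = (map v [0..<K], map (\<lambda>j. map (\<lambda>i. v (K + j * M + i)) [0..<M]) [0..<q])"

text \<open>The data fix the first \<open>K + M * q\<close> digits. Only \<open>M * q\<close> of
  them are used, which gives a bound independent of \<open>K\<close>.\<close>

lemma prefix_data_bin_val:
  assumes "bin_seq v" "bin_seq w" and "M > 0" and "prefix_data M K q v = prefix_data M K q w"
  shows "\<bar>bin_val v - bin_val w\<bar> \<le> 1 / 2 ^ (M * q)"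
proof (rule bin_val_prefix[OF assms(1,2)])
  fix i assume i: "i < M * q"
  show "v i = w i"
  proof (cases "i < K")
    case True
    then show ?thesis using assms(4) by (simp add: prefix_data_def)
  next
    case False
    define j r where "j = (i - K) div M" and "r = (i - K) mod M"
    have "j * M \<le> i - K" by (simp add: j_def)
    also have "\<dots> < q * M" using i by (simp add: mult.commute)
    finally have "j < q" by simp
    moreover have "r < M" using assms(3) by (simp add: r_def)
    moreover have "i = K + j * M + r" using False by (simp add: j_def r_def)
    ultimately show ?thesis using assms(4) by (simp add: prefix_data_def)
  qed
qed

definition prefix_words :: "nat \<Rightarrow> nat list set \<Rightarrow> nat \<Rightarrow> (nat list \<times> nat list list) set" where
  "prefix_words K W q =
     {xs. set xs \<subseteq> {0, 1} \<and> length xs = K} \<times> {xs. set xs \<subseteq> W \<and> length xs = q}"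

lemma finite_prefix_words: "finite W \<Longrightarrow> finite (prefix_words K W q)"
  by (simp add: prefix_words_def finite_lists_length_eq)

lemma card_prefix_words: "finite W \<Longrightarrow> card (prefix_words K W q) = 2 ^ K * card W ^ q"
  using card_lists_length_eq[of "{0, 1 :: nat}" K] card_lists_length_eq[of W q]
  by (simp add: prefix_words_def card_cartesian_product numeral_2_eq_2[symmetric])

lemma prefix_data_in_prefix_words:
  assumes "bin_seq v" and "blocks_in M K W v"
  shows "prefix_data M K q v \<in> prefix_words K W q"
proof -
  have "v ` A \<subseteq> {0, 1}" for A
    using assms(1) unfolding bin_seq_def by (simp only: image_subset_iff) blast
  with assms(2) show ?thesis
    by (auto simp: prefix_data_def prefix_words_def blocks_in_def image_subset_iff)
qed

text \<open>After \<open>q\<close> blocks there are at most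
  \<open>2 ^ K * 2 ^ K' * (M + 1) ^ (2 * q)\<close> pairs of prefixes, each confining the point to a
  set of diameter at most \<open>2 / 2 ^ (M * q)\<close>. The resulting sum is at most
  \<open>C * r ^ q\<close> with \<open>r < 1\<close>.\<close>

lemma hausdorff_null_block_piece:
  assumes s: "s > 0" and M: "M > 0" "(real M + 1)\<^sup>2 < 2 powr (real M * s)"
    and W: "finite W" "card W \<le> M + 1" and W': "finite W'" "card W' \<le> M + 1"
  shows "hausdorff_null s (block_piece M K W K' W')"
proof (rule hausdorff_null_finite_covers[OF s])
  fix e :: real
  assume e: "e > 0"
  \<comment> \<open>\<open>C\<close> collects the factors independent of \<open>q\<close>: the free
    initial digits and the 2 in the diameter bound \<open>d\<close>, which comes from adding the
    errors of two coordinates.\<close>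
  define C where "C = 2 ^ K * 2 ^ K' * 2 powr s"
  define r where "r = (real M + 1)\<^sup>2 / 2 powr (real M * s)"
  have r: "0 \<le> r" "r < 1" using M by (auto simp: r_def)
  have C: "C > 0" by (simp add: C_def)
  from real_arch_pow_inv[of "e / C" r] obtain q where "r ^ q < e / C" using r e C by auto
  then have q: "C * r ^ q \<le> e" using C by (simp add: field_simps)
  define I where "I = prefix_words K W q \<times> prefix_words K' W' q"
  define U where "U = (\<lambda>(a, b). {(bin_val v, bin_val w) | v w. bin_seq v \<and> bin_seq w \<and>
     prefix_data M K q v = a \<and> prefix_data M K' q w = b})"
  define d where "d = 2 / (2::real) ^ (M * q)"
  have d: "0 \<le> d" by (simp add: d_def)
  have dist: "dist p p' \<le> d" if p: "p \<in> U i" "p' \<in> U i" for p p' i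
  proof -
    obtain v w v' w' where vw: "bin_seq v" "bin_seq w" "bin_seq v'" "bin_seq w'"
      "prefix_data M K q v = prefix_data M K q v'" "prefix_data M K' q w = prefix_data M K' q w'"
      and pp: "p = (bin_val v, bin_val w)" "p' = (bin_val v', bin_val w')"
      using p by (cases i) (auto simp: U_def)
    have "dist p p' \<le> \<bar>bin_val v - bin_val v'\<bar> + \<bar>bin_val w - bin_val w'\<bar>"
      using sqrt_sum_squares_le_sum_abs[of "bin_val v - bin_val v'" "bin_val w - bin_val w'"]
      by (simp add: pp dist_Pair_Pair dist_real_def)
    also have "\<dots> \<le> d"
      using prefix_data_bin_val[OF vw(1,3) M(1) vw(5)] prefix_data_bin_val[OF vw(2,4) M(1) vw(6)]
      by (simp add: d_def)
    finally show ?thesis .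
  qed
  have "finite I" using W W' by (simp add: I_def finite_prefix_words)
  moreover have "block_piece M K W K' W' \<subseteq> (\<Union>i\<in>I. U i)"
  proof
    fix p assume "p \<in> block_piece M K W K' W'"
    then obtain v w where vw: "bin_seq v" "bin_seq w" "blocks_in M K W v" "blocks_in M K' W' w"
      and p: "p = (bin_val v, bin_val w)"
      unfolding block_piece_def by blast
    have "(prefix_data M K q v, prefix_data M K' q w) \<in> I"
      unfolding I_def using vw by (intro SigmaI prefix_data_in_prefix_words)
    moreover have "p \<in> U (prefix_data M K q v, prefix_data M K' q w)"
      unfolding U_def p using vw by blast
    ultimately show "p \<in> (\<Union>i\<in>I. U i)" by (rule UN_I)
  qed
  moreover have "bounded (U i)" for i
    unfolding bounded_two_points using dist by blast
  moreover have "diameter (U i) \<le> d" for i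
    using dist d by (intro diameter_le) (auto simp: dist_norm)
  moreover have "real (card I) * d powr s \<le> e"
  proof -
    have d_eq: "d powr s = 2 powr s / (2 powr (real M * s)) ^ q"
      unfolding d_def by (simp add: powr_divide powr_realpow[symmetric] powr_powr mult_ac)
    have "real (card I) = 2 ^ K * 2 ^ K' * (real (card W) ^ q * real (card W') ^ q)"
      using W W' by (simp add: I_def card_cartesian_product card_prefix_words)
    also have "\<dots> \<le> 2 ^ K * 2 ^ K' * ((real M + 1) ^ q * (real M + 1) ^ q)"
      using W(2) W'(2) by (intro mult_left_mono mult_mono power_mono) auto
    also have "\<dots> = 2 ^ K * 2 ^ K' * ((real M + 1)\<^sup>2) ^ q"
      by (simp add: power2_eq_square power_mult_distrib)
    finally have "real (card I) * d powr s \<le> 2 ^ K * 2 ^ K' * ((real M + 1)\<^sup>2) ^ q * d powr s"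
      by (rule mult_right_mono) simp
    also have "\<dots> = C * r ^ q"
      by (simp add: d_eq C_def r_def power_divide)
    finally show ?thesis using q by (rule order_trans)
  qed
  ultimately show "\<exists>(I :: ((nat list \<times> nat list list) \<times> nat list \<times> nat list list) set) U d.
      finite I \<and> block_piece M K W K' W' \<subseteq> (\<Union>i\<in>I. U i) \<and>
      (\<forall>i\<in>I. bounded (U i) \<and> diameter (U i) \<le> d) \<and> 0 \<le> d \<and> real (card I) * d powr s \<le> e"
    using d by blast
qed

text \<open>The exponential outgrows the square, and multiples of \<open>p\<close> are arbitrarily
  large.\<close>

lemma exists_block_length:
  assumes s: "s > 0" and p: "p > (0::nat)"
  shows "\<exists>M>0. p dvd M \<and> (real M + 1)\<^sup>2 < 2 powr (real M * s)"
proof -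
  have "eventually (\<lambda>x::real. (x + 1)\<^sup>2 < 2 powr (x * s)) at_top"
    using s by real_asymp
  then obtain x0 where x0: "\<And>x. x \<ge> x0 \<Longrightarrow> (x + 1)\<^sup>2 < 2 powr (x * s)"
    by (auto simp: eventually_at_top_linorder)
  obtain m :: nat where m: "x0 \<le> real m" using real_arch_simple by blast
  define M where "M = p * (m + 1)"
  have "1 * m \<le> M" unfolding M_def using p by (intro mult_le_mono) auto
  with m have "x0 \<le> real M" by simp
  moreover have "M > 0" "p dvd M" using p by (simp_all add: M_def)
  ultimately show ?thesis using x0 by blast
qed

text \<open>There are only countably many finite sets of words, hence countably many pieces, each of
  them null.\<close>

lemma hausdorff_null_tame:
  assumes s: "s > 0"
  shows "hausdorff_null s {(bin_val v, bin_val w) | v w. bin_seq v \<and> bin_seq w \<and> tame v \<and> tame w}"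
proof -
  define Ws where "Ws = {W :: nat list set. finite W}"
  define I where "I = {(M, K :: nat, W, K' :: nat, W'). M > 0 \<and> (real M + 1)\<^sup>2 < 2 powr (real M * s) \<and>
    W \<in> Ws \<and> card W \<le> M + 1 \<and> W' \<in> Ws \<and> card W' \<le> M + 1}"
  have "countable Ws" unfolding Ws_def by (rule countable_Collect_finite)
  then have "countable ((UNIV :: nat set) \<times> (UNIV :: nat set) \<times> Ws \<times> (UNIV :: nat set) \<times> Ws)"
    by (intro countable_SIGMA) auto
  then have "countable I"  by (rule countable_subset[rotated]) (auto simp: I_def)
  then have "hausdorff_null s (\<Union>(M, K, W, K', W')\<in>I. block_piece M K W K' W')"
    by (rule hausdorff_null_countable_UN)
      (auto simp: I_def Ws_def intro!: hausdorff_null_block_piece[OF s])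
  then show ?thesis
  proof (rule hausdorff_null_subset, safe)
    fix v w assume v: "bin_seq v" "tame v" and w: "bin_seq w" "tame w"
    from v(2) obtain p where p: "p > 0"
      "\<And>M. M > 0 \<Longrightarrow> p dvd M \<Longrightarrow> \<exists>K W. finite W \<and> card W \<le> M + 1 \<and> blocks_in M K W v"
      unfolding tame_def by blast
    from w(2) obtain p' where p': "p' > 0"
      "\<And>M. M > 0 \<Longrightarrow> p' dvd M \<Longrightarrow> \<exists>K W. finite W \<and> card W \<le> M + 1 \<and> blocks_in M K W w"
      unfolding tame_def by blast
    \<comment> \<open>A multiple of \<open>p * p'\<close> is an admissible block length for both
      sequences at once.\<close>
    obtain M where M: "M > 0" "p * p' dvd M" "(real M + 1)\<^sup>2 < 2 powr (real M * s)"
      using exists_block_length[OF s, of "p * p'"] p p' by auto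
    have "p dvd M" "p' dvd M" using M(2) by (auto intro: dvd_mult_left dvd_mult_right)
    obtain K W where W: "finite W" "card W \<le> M + 1" "blocks_in M K W v"
      using p(2)[OF M(1) \<open>p dvd M\<close>] by blast
    obtain K' W' where W': "finite W'" "card W' \<le> M + 1" "blocks_in M K' W' w"
      using p'(2)[OF M(1) \<open>p' dvd M\<close>] by blast
    have "(M, K, W, K', W') \<in> I" using M W W' by (simp add: I_def Ws_def)
    moreover have "(bin_val v, bin_val w) \<in> block_piece M K W K' W'"
      using v w W W' unfolding block_piece_def by blast
    ultimately show "(bin_val v, bin_val w) \<in> (\<Union>(M, K, W, K', W')\<in>I. block_piece M K W K' W')"
      by blast
  qed
qed

theorem theorem3p4:
  shows "dimension_trap Delta"
  unfolding dimension_trap_def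
proof
  \<comment> \<open>\<open>Delta\<close> is an interior, hence open in the plane, and it lies in the
    square.\<close>
  show "openin (top_of_set unit_square) Delta"
    by (intro open_subset Delta_subset_unit_square) (simp add: Delta_def)
  show "hausdorff_dim (survivor_set Delta) = 0"
  proof (rule hausdorff_dim_eq_0)
    fix s :: real assume "s > 0"
    show "hausdorff_null s (survivor_set Delta)"
    proof (rule hausdorff_null_subset[OF hausdorff_null_tame[OF \<open>s > 0\<close>]])
      show "survivor_set Delta \<subseteq>
          {(bin_val v, bin_val w) | v w. bin_seq v \<and> bin_seq w \<and> tame v \<and> tame w}"
      proof
        fix p assume "p \<in> survivor_set Delta"
        then obtain u where p: "p = coding u" and u: "u \<in> binary_seqs"
          and "\<And>n. coding (shift n u) \<notin> Delta"
          by (auto simp: survivor_set_def)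
        then have "avoids u" unfolding avoids_def using Delta_superset by metis
        then show "p \<in> {(bin_val v, bin_val w) | v w. bin_seq v \<and> bin_seq w \<and> tame v \<and> tame w}"
          using tame_right_half[OF u] tame_left_half[OF u] bin_seq_halves[OF u] p coding_eq by blast
      qed
    qed
  qed
qed

end
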